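(* Let $A\in\mathbb{R}^{n\times n}$ be symmetric positive definite with all eigenvalues in $[a,b]$, where $0<a<b$, and let $p\ge1$. Let $\psi_N$ be the degree-$N$ Chebyshev approximation of $x^{p/2}$ on $[a,b]$, let $\phi_N(A)=[\psi_N(A)]^2$, let $(w_j)_{j\ge1}$ be a sequence of independent standard Gaussian random vectors in $\mathbb{R}^n$, and for $M\ge1$ let $$Y_{M,N}=\left(\frac1M\sum_{j=1}^M w_j^T\phi_N(A)w_j\right)^{1/p}.$$ Then for fixed $N$: 1. $Y_{M,N}\ge0$ for all $M$; 2. $\lim_{M\to\infty}Y_{M,N}=\big(\operatorname{tr}(\phi_N(A))\big)^{1/p}$ almost surely; 3. $\mathbb{E}(Y_{M,N})\le\big(\operatorname{tr}(\phi_N(A))\big)^{1/p}$; 4. $\operatorname{Var}(Y_{M,N})\le\dfrac{2\,\|\phi_N(A)\|_F^2}{M\,\big(\operatorname{tr}(\phi_N(A))\big)^{2-2/p}}$.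
   Context: Chebyshev approximation: $T_j(x)=\cos(j\arccos x)$, $x\in[-1,1]$, is the $j$th Chebyshev polynomial of the first kind. The degree-$N$ Chebyshev approximation of $g(x)=x^{p/2}$ on $[a,b]$ is the truncated Chebyshev series $$\psi_N(x)=c_0+\sum_{j=1}^N c_j\,T_j\Big(\frac{2}{b-a}x-\frac{b+a}{b-a}\Big),$$ where $c_j=\frac2\pi\int_0^\pi g\big(\tfrac{b-a}{2}\cos\theta+\tfrac{b+a}{2}\big)\cos(j\theta)\,d\theta$ for $j\ge1$ and $c_0=\frac1\pi\int_0^\pi g\big(\tfrac{b-a}{2}\cos\theta+\tfrac{b+a}{2}\big)\,d\theta$. The polynomials $\psi_N$ and $\phi_N=\psi_N^2$ are applied to matrices as matrix polynomials. $\|\cdot\|_F$ is the Frobenius norm. The samples $w_j$ are independent random vectors on a probability space $(\Omega,\mathcal{F},\mathbb{P})$ whose entries are independent standard normal random variables. *)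

theory Defs
  imports "HOL-Probability.Probability" "HOL-Computational_Algebra.Polynomial"
begin

section \<open>Chebyshev approximation\<close>

text \<open>The Chebyshev polynomial of the first kind as a formal polynomial, so that it can be
  applied to matrices; lemma \<open>cheb_poly\<close> below shows that the description is not vacuous.\<close>

definition cheb :: "nat \<Rightarrow> real poly" where
  "cheb j = (THE q. \<forall>x\<in>{-1..1}. poly q x = cos (real j * arccos x))"

definition cheb_coeff :: "(real \<Rightarrow> real) \<Rightarrow> real \<Rightarrow> real \<Rightarrow> nat \<Rightarrow> real" where
  "cheb_coeff g a b j =
     (if j = 0
      then (1 / pi) * integral {0..pi} (\<lambda>\<theta>. g ((b - a) / 2 * cos \<theta> + (b + a) / 2))
      else (2 / pi) * integral {0..pi}
             (\<lambda>\<theta>. g ((b - a) / 2 * cos \<theta> + (b + a) / 2) * cos (real j * \<theta>)))"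

definition cheb_approx :: "(real \<Rightarrow> real) \<Rightarrow> real \<Rightarrow> real \<Rightarrow> nat \<Rightarrow> real poly" where
  "cheb_approx g a b N =
     [:cheb_coeff g a b 0:] +
     (\<Sum>j = 1..N. smult (cheb_coeff g a b j)
                    (pcompose (cheb j) [:- ((b + a) / (b - a)), 2 / (b - a):]))"

lemma cheb_ex1: "\<exists>!q :: real poly. \<forall>x\<in>{-1..1}. poly q x = cos (real j * arccos x)"
proof (rule ex_ex1I)
  have "(\<exists>q :: real poly. \<forall>x\<in>{-1..1}. poly q x = cos (real j * arccos x)) \<and>
        (\<exists>q :: real poly. \<forall>x\<in>{-1..1}. poly q x = cos (real (Suc j) * arccos x))"
  proof (induction j)
    case 0
    show ?case
      by (intro conjI exI[of _ "1 :: real poly"] exI[of _ "[:0, 1:] :: real poly"]) auto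
  next
    case (Suc j)
    then obtain q r :: "real poly" where
      q: "\<And>x. x \<in> {-1..1} \<Longrightarrow> poly q x = cos (real j * arccos x)" and
      r: "\<And>x. x \<in> {-1..1} \<Longrightarrow> poly r x = cos (real (Suc j) * arccos x)"
      by blast
    have "poly ([:0, 2:] * r - q) x = cos (real (Suc (Suc j)) * arccos x)"
      if x: "x \<in> {-1..1}" for x
    proof -
      define t where "t = arccos x"
      have "cos (real (Suc (Suc j)) * t) + cos (real j * t) = 2 * cos t * cos (real (Suc j) * t)"
        using cos_add[of "real (Suc j) * t" t] cos_diff[of "real (Suc j) * t" t]
        by (simp add: algebra_simps)
      moreover have "cos t = x"
        using x by (simp add: t_def)
      ultimately show ?thesis
        using q[OF x] r[OF x] by (simp add: t_def algebra_simps)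
    qed
    then show ?case using r by blast
  qed
  then show "\<exists>q :: real poly. \<forall>x\<in>{-1..1}. poly q x = cos (real j * arccos x)" ..
next
  fix q r :: "real poly"
  assume "\<forall>x\<in>{-1..1}. poly q x = cos (real j * arccos x)"
    and "\<forall>x\<in>{-1..1}. poly r x = cos (real j * arccos x)"
  then have "{-1..1} \<subseteq> {x. poly (q - r) x = 0}" by auto
  then have "infinite {x. poly (q - r) x = 0}"
    by (rule infinite_super) (simp add: infinite_Icc)
  then show "q = r"
    using poly_roots_finite[of "q - r"] by auto
qed

lemma cheb_poly:
  assumes "x \<in> {-1..1}"
  shows "poly (cheb j) x = cos (real j * arccos x)"
  using theI'[OF cheb_ex1[of j]] assms unfolding cheb_def by blast


section \<open>Matrices\<close>

text \<open>The library's product and power of the type \<open>real ^ 'n ^ 'n\<close> act componentwise, hence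
  the powers with respect to matrix multiplication.\<close>

primrec matpow :: "real ^ 'n ^ 'n \<Rightarrow> nat \<Rightarrow> real ^ 'n ^ 'n" where
  "matpow A 0 = mat 1"
| "matpow A (Suc k) = A ** matpow A k"

definition poly_mat :: "real poly \<Rightarrow> real ^ 'n ^ 'n \<Rightarrow> real ^ 'n ^ 'n" where
  "poly_mat q A = (\<Sum>i\<le>degree q. coeff q i *\<^sub>R matpow A i)"

definition symmetric_mat :: "real ^ 'n ^ 'n \<Rightarrow> bool" where
  "symmetric_mat A \<longleftrightarrow> transpose A = A"

definition pos_def_mat :: "real ^ 'n ^ 'n \<Rightarrow> bool" where
  "pos_def_mat A \<longleftrightarrow> (\<forall>x. x \<noteq> 0 \<longrightarrow> 0 < x \<bullet> (A *v x))"

definition eigenvalue_mat :: "real ^ 'n ^ 'n \<Rightarrow> real \<Rightarrow> bool" where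
  "eigenvalue_mat A \<mu> \<longleftrightarrow> (\<exists>x. x \<noteq> 0 \<and> A *v x = \<mu> *\<^sub>R x)"

definition phi_mat :: "real \<Rightarrow> real \<Rightarrow> real \<Rightarrow> nat \<Rightarrow> real ^ 'n ^ 'n \<Rightarrow> real ^ 'n ^ 'n" where
  "phi_mat p a b N A =
     (let \<psi> = poly_mat (cheb_approx (\<lambda>x. x powr (p / 2)) a b N) A in \<psi> ** \<psi>)"

text \<open>The library's norm on \<open>real ^ 'n ^ 'n\<close> is the Frobenius norm.\<close>

lemma norm_eq_Frobenius:
  fixes A :: "real ^ 'n ^ 'n"
  shows "norm A = sqrt (\<Sum>i\<in>UNIV. \<Sum>j\<in>UNIV. (A $ i $ j)\<^sup>2)"
  by (simp add: norm_vec_def L2_set_def sum_nonneg)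


section \<open>Gaussian samples and the estimator\<close>

text \<open>Only the vectors \<open>w j\<close> with \<open>j \<ge> 1\<close> are used as samples.\<close>

definition std_gaussian_samples :: "'a measure \<Rightarrow> (nat \<Rightarrow> 'a \<Rightarrow> real ^ 'n) \<Rightarrow> bool" where
  "std_gaussian_samples P w \<longleftrightarrow>
     prob_space.indep_vars P (\<lambda>_. borel) w {1..} \<and>
     (\<forall>j\<ge>1. prob_space.indep_vars P (\<lambda>_. borel) (\<lambda>i \<omega>. w j \<omega> $ i) UNIV \<and>
            (\<forall>i. distributed P lborel (\<lambda>\<omega>. w j \<omega> $ i) std_normal_density))"

definition sample_mean ::
  "real ^ 'n ^ 'n \<Rightarrow> (nat \<Rightarrow> 'a \<Rightarrow> real ^ 'n) \<Rightarrow> nat \<Rightarrow> 'a \<Rightarrow> real" where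
  "sample_mean B w M \<omega> = (1 / real M) * (\<Sum>j = 1..M. w j \<omega> \<bullet> (B *v w j \<omega>))"

definition estimator ::
  "real \<Rightarrow> real ^ 'n ^ 'n \<Rightarrow> (nat \<Rightarrow> 'a \<Rightarrow> real ^ 'n) \<Rightarrow> nat \<Rightarrow> 'a \<Rightarrow> real" where
  "estimator p B w M \<omega> = sample_mean B w M \<omega> powr (1 / p)"

end

theory Submission
  imports Defs "HOL-Library.Discrete_Functions" "HOL-Real_Asymp.Real_Asymp"
begin

text \<open>
  Since \<open>B = S ** S\<close> with \<open>S\<close> symmetric, each \<open>w \<bullet> (B *v w)\<close> is
  the squared norm of \<open>S *v w\<close>. The fourth-order product moments of independent standard normals
  (Isserlis) give it mean \<open>trace B\<close> and variance twice the squared Frobenius norm of \<open>B\<close>.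
  For nonnegative terms with bounded variances the strong law needs only second moments: almost sure
  convergence along the squares follows because the variances of the averages are summable there,
  and monotonicity of the partial sums interpolates.
  With \<open>\<mu> = trace B\<close> and \<open>q = 1 / p \<le> 1\<close>, the bound on the expectation is the tangent
  inequality of the concave function \<open>x powr q\<close> at \<open>\<mu>\<close>. The bound on the variance
  comes from \<open>\<bar>x powr q - \<mu> powr q\<bar> \<le> \<mu> powr (q - 1) * \<bar>x - \<mu>\<bar>\<close>, the variance
  being at most the second moment about \<open>\<mu> powr q\<close>.
\<close>

subsection \<open>Quadratic forms of symmetric matrices\<close>

lemma transpose_sum: "transpose (\<Sum>i\<in>I. f i) = (\<Sum>i\<in>I. transpose (f i))"
  by (simp add: transpose_def vec_eq_iff)

text \<open>Transposition reverses products, so the symmetry induction for powers meets the new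
  factor on the other side.\<close>

lemma matpow_commute: "matpow A k ** A = A ** matpow A k"
  by (induction k) (simp_all add: matrix_mul_assoc [symmetric])

lemma symmetric_matpow:
  assumes "symmetric_mat A"
  shows "symmetric_mat (matpow A k)"
proof (induction k)
  case 0
  show ?case by (simp add: symmetric_mat_def)
next
  case (Suc k)
  then show ?case
    using assms by (simp add: symmetric_mat_def matrix_transpose_mul matpow_commute)
qed

lemma symmetric_poly_mat:
  assumes "symmetric_mat A"
  shows "symmetric_mat (poly_mat q A)"
  using symmetric_matpow [OF assms]
  by (simp add: symmetric_mat_def poly_mat_def transpose_sum transpose_scalar)

lemma symmetric_square:
  "symmetric_mat S \<Longrightarrow> symmetric_mat (S ** S)"
  by (simp add: symmetric_mat_def matrix_transpose_mul)

lemma inner_square_nonneg: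
  fixes S :: "real ^ 'n ^ 'n"
  assumes "symmetric_mat S"
  shows "0 \<le> x \<bullet> ((S ** S) *v x)"
proof -
  have "x \<bullet> ((S ** S) *v x) = (S *v x) \<bullet> (S *v x)"
    using assms dot_lmul_matrix [of x S "S *v x"]
    by (simp add: symmetric_mat_def matrix_vector_mul_assoc [symmetric])
      (metis transpose_matrix_vector)
  then show ?thesis by simp
qed

text \<open>Contraction with a Kronecker delta. Deltas are written with \<open>of_bool\<close> so
  that the moment formulas stay sums and products of numbers.\<close>

lemma sum_mult_of_bool_eq:
  fixes f :: "'i::finite \<Rightarrow> 'b::semiring_1"
  shows "(\<Sum>j\<in>UNIV. f j * of_bool (i = j)) = f i"
  by (simp add: of_bool_def if_distrib cong: if_cong)

lemma inner_matrix_vector_eq_sum: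
  fixes B :: "real ^ 'n ^ 'n"
  shows "x \<bullet> (B *v x) = (\<Sum>i\<in>UNIV. \<Sum>j\<in>UNIV. B $ i $ j * (x $ i * x $ j))"
  by (simp add: inner_vec_def matrix_vector_mult_def sum_distrib_left mult.left_commute)

lemma norm_matrix_squared:
  fixes B :: "real ^ 'n ^ 'n"
  shows "(norm B)\<^sup>2 = (\<Sum>i\<in>UNIV. \<Sum>j\<in>UNIV. (B $ i $ j)\<^sup>2)"
  by (simp add: norm_eq_Frobenius sum_nonneg)

subsection \<open>Moments of Gaussian quadratic forms\<close>

definition std_normal_moment :: "nat \<Rightarrow> real" where
  "std_normal_moment k = integral\<^sup>L lborel (\<lambda>x. std_normal_density x * x ^ k)"

text \<open>Exponent 3 can be left out: in a product of four factors, an index that occurs three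
  times leaves another that occurs once, and the first moment is 0.\<close>

lemma std_normal_moment_values:
  "std_normal_moment 0 = 1" "std_normal_moment (Suc 0) = 0"
  "std_normal_moment 2 = 1" "std_normal_moment 4 = 3"
  unfolding std_normal_moment_def
  using integral_std_normal_moment_even [of 0] integral_std_normal_moment_odd [of 0]
    integral_std_normal_moment_even [of 1] integral_std_normal_moment_even [of 2]
  by (simp_all add: fact_numeral)

lemma (in prob_space) std_normal_power:
  assumes "distributed M lborel X std_normal_density"
  shows "has_bochner_integral M (\<lambda>\<omega>. X \<omega> ^ k) (std_normal_moment k)"
  using distributed_integrable [OF assms, of "\<lambda>x. x ^ k"]
    distributed_integral [OF assms, of "\<lambda>x. x ^ k"]
    integrable_std_normal_moment [of k]
  by (simp add: has_bochner_integral_iff std_normal_moment_def)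

text \<open>Writes a single coordinate as a monomial in all coordinates; multiplying coordinates
  then adds exponents.\<close>

lemma prod_pow_of_bool:
  fixes g :: "'i::finite \<Rightarrow> real"
  shows "(\<Prod>m\<in>UNIV. g m ^ of_bool (i = m)) = g i"
  using prod.remove [of UNIV i "\<lambda>m. g m ^ of_bool (i = m)"] by simp

context prob_space
begin

text \<open>Powers of independent variables are independent, so the expectation factors into
  one-dimensional moments.\<close>

lemma monomial_std_normal:
  fixes g :: "'i::finite \<Rightarrow> 'a \<Rightarrow> real"
  assumes "indep_vars (\<lambda>_. borel) g UNIV"
    and "\<And>i. distributed M lborel (g i) std_normal_density"
  shows "has_bochner_integral M (\<lambda>\<omega>. \<Prod>m\<in>UNIV. g m \<omega> ^ c m)
           (\<Prod>m\<in>UNIV. std_normal_moment (c m))"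
proof -
  have indep: "indep_vars (\<lambda>_. borel) (\<lambda>m \<omega>. g m \<omega> ^ c m) UNIV"
    by (rule indep_vars_compose2 [OF assms(1)]) simp
  have int: "integrable M (\<lambda>\<omega>. g m \<omega> ^ c m)"
    and mom: "expectation (\<lambda>\<omega>. g m \<omega> ^ c m) = std_normal_moment (c m)" for m
    using std_normal_power [OF assms(2)] by (auto simp: has_bochner_integral_iff)
  show ?thesis
    using indep_vars_lebesgue_integral [OF _ indep] indep_vars_integrable [OF _ indep] int
    by (simp add: has_bochner_integral_iff mom)
qed

lemma std_normal_product2:
  fixes g :: "'i::finite \<Rightarrow> 'a \<Rightarrow> real"
  assumes "indep_vars (\<lambda>_. borel) g UNIV"
    and "\<And>i. distributed M lborel (g i) std_normal_density"
  shows "has_bochner_integral M (\<lambda>\<omega>. g i \<omega> * g j \<omega>) (of_bool (i = j))"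
proof -
  \<comment> \<open>\<open>c m\<close> counts the occurrences of \<open>m\<close> among the indices,
    which makes the product a monomial with exponents \<open>c\<close>.\<close>
  define c :: "'i \<Rightarrow> nat" where "c m = of_bool (i = m) + of_bool (j = m)" for m
  have "(\<Prod>m\<in>UNIV. std_normal_moment (c m)) = of_bool (i = j)"
  proof (cases "i = j")
    case True
    then show ?thesis
      by (auto simp: c_def std_normal_moment_values numeral_2_eq_2 [symmetric] intro!: prod.neutral)
  next
    case False
    then have "c i = Suc 0" by (simp add: c_def)
    then have "\<exists>m\<in>UNIV. std_normal_moment (c m) = 0"
      by (metis UNIV_I std_normal_moment_values(2))
    with False show ?thesis
      by (simp add: prod_zero)
  qed
  then show ?thesis
    using monomial_std_normal [OF assms, of c]
    by (simp add: c_def power_add prod.distrib prod_pow_of_bool)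
qed

text \<open>Isserlis: the value counts the pairings of the four positions that join equal indices.
  Two distinct pairs admit one such pairing; four equal indices admit all three, in accordance with
  the fourth moment 3.\<close>

lemma std_normal_product4:
  fixes g :: "'i::finite \<Rightarrow> 'a \<Rightarrow> real"
  assumes "indep_vars (\<lambda>_. borel) g UNIV"
    and "\<And>i. distributed M lborel (g i) std_normal_density"
  shows "has_bochner_integral M (\<lambda>\<omega>. g i \<omega> * g j \<omega> * g k \<omega> * g l \<omega>)
    (of_bool (i = j \<and> k = l) + of_bool (i = k \<and> j = l) + of_bool (i = l \<and> j = k))"
proof -
  define c :: "'i \<Rightarrow> nat" where
    "c m = of_bool (i = m) + of_bool (j = m) + of_bool (k = m) + of_bool (l = m)" for m
  let ?R = "of_bool (i = j \<and> k = l) + of_bool (i = k \<and> j = l) + of_bool (i = l \<and> j = k) :: real"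
  have zero: "(\<Prod>m\<in>UNIV. std_normal_moment (c m)) = 0" if "c m = Suc 0" for m
    by (rule prod_zero) (use that in \<open>auto intro!: exI [of _ m] simp: std_normal_moment_values\<close>)
  have one: "(\<Prod>m\<in>UNIV. std_normal_moment (c m)) = 1" if "\<And>m. c m = 0 \<or> c m = 2"
    using that by (intro prod.neutral) (metis std_normal_moment_values(1,3))
  have "(\<Prod>m\<in>UNIV. std_normal_moment (c m)) = ?R"
  proof (cases "i = j \<and> i = k \<and> i = l")
    case True
    then have "c m = (if m = i then 4 else 0)" for m
      by (auto simp: c_def)
    then have "std_normal_moment (c m) = (if m = i then 3 else 1)" for m
      by (simp add: std_normal_moment_values)
    moreover have "?R = 3"
      using True by auto
    ultimately show ?thesis by simp
  next
    case False
    \<comment> \<open>Unless the four indices form two distinct pairs, one of them occurs exactly once, and the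
      vanishing first moment kills the product.\<close>
    then have "i = j \<and> k = l \<and> i \<noteq> k \<or> i = k \<and> j = l \<and> i \<noteq> j \<or> i = l \<and> j = k \<and> i \<noteq> j \<or>
        (c i = Suc 0 \<or> c j = Suc 0 \<or> c k = Suc 0 \<or> c l = Suc 0) \<and> ?R = 0"
      unfolding c_def
      by (cases "i = j"; cases "k = l"; cases "i = k"; cases "j = l"; cases "i = l"; cases "j = k"; simp)
    then consider "i = j" "k = l" "i \<noteq> k" | "i = k" "j = l" "i \<noteq> j" | "i = l" "j = k" "i \<noteq> j"
      | "c i = Suc 0 \<or> c j = Suc 0 \<or> c k = Suc 0 \<or> c l = Suc 0" "?R = 0"
      by blast
    then show ?thesis
    proof cases
      case 4
      then show ?thesis using zero by auto
    qed (subst one; auto simp: c_def)+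
  qed
  then show ?thesis
    using monomial_std_normal [OF assms, of c]
    by (simp add: c_def power_add prod.distrib prod_pow_of_bool mult.assoc)
qed

lemma has_bochner_integral_cmult:
  fixes f :: "'a \<Rightarrow> real"
  shows "has_bochner_integral M f x \<Longrightarrow> has_bochner_integral M (\<lambda>\<omega>. c * f \<omega>) (c * x)"
  by (rule has_bochner_integral_mult_right)

lemma has_bochner_integral_const:
  fixes c :: real
  shows "has_bochner_integral M (\<lambda>_. c) c"
  by (simp add: has_bochner_integral_iff prob_space)

lemma std_normal_quadratic_form:
  fixes B :: "real ^ 'n ^ 'n" and x :: "'a \<Rightarrow> real ^ 'n"
  assumes "indep_vars (\<lambda>_. borel) (\<lambda>i \<omega>. x \<omega> $ i) UNIV"
    and "\<And>i. distributed M lborel (\<lambda>\<omega>. x \<omega> $ i) std_normal_density"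
    and "symmetric_mat B"
  shows "has_bochner_integral M (\<lambda>\<omega>. x \<omega> \<bullet> (B *v x \<omega>)) (trace B)"
    and "has_bochner_integral M (\<lambda>\<omega>. (x \<omega> \<bullet> (B *v x \<omega>) - trace B)\<^sup>2) (2 * (norm B)\<^sup>2)"
proof -
  let ?Q = "\<lambda>\<omega>. x \<omega> \<bullet> (B *v x \<omega>)"
  have "has_bochner_integral M ?Q (\<Sum>i\<in>UNIV. \<Sum>j\<in>UNIV. B $ i $ j * of_bool (i = j))"
    unfolding inner_matrix_vector_eq_sum
    by (intro has_bochner_integral_sum has_bochner_integral_cmult
        std_normal_product2 [OF assms(1,2)])
  then show Q: "has_bochner_integral M ?Q (trace B)"
    by (simp only: sum_mult_of_bool_eq trace_def)
  have sym: "B $ j $ i = B $ i $ j" for i j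
    using assms(3) by (simp add: symmetric_mat_def transpose_def vec_eq_iff)
  \<comment> \<open>The square is a quadruple sum of fourth-order products, to which Isserlis
    applies term by term.\<close>
  have Q2_eq: "(?Q \<omega>)\<^sup>2 = (\<Sum>i\<in>UNIV. \<Sum>j\<in>UNIV. \<Sum>k\<in>UNIV. \<Sum>l\<in>UNIV. B $ i $ j * B $ k $ l *
      (x \<omega> $ i * x \<omega> $ j * x \<omega> $ k * x \<omega> $ l))" for \<omega>
  proof -
    have "(?Q \<omega>)\<^sup>2 = (\<Sum>i\<in>UNIV. \<Sum>j\<in>UNIV. B $ i $ j * (x \<omega> $ i * x \<omega> $ j) * ?Q \<omega>)"
      by (simp only: power2_eq_square sum_distrib_right [symmetric] inner_matrix_vector_eq_sum)
    also have "\<dots> = (\<Sum>i\<in>UNIV. \<Sum>j\<in>UNIV. \<Sum>k\<in>UNIV. \<Sum>l\<in>UNIV. B $ i $ j * B $ k $ l *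
      (x \<omega> $ i * x \<omega> $ j * x \<omega> $ k * x \<omega> $ l))"
      by (intro sum.cong refl) (simp add: inner_matrix_vector_eq_sum sum_distrib_left mult_ac)
    finally show ?thesis .
  qed
  have "has_bochner_integral M (\<lambda>\<omega>. (?Q \<omega>)\<^sup>2)
     (\<Sum>i\<in>UNIV. \<Sum>j\<in>UNIV. \<Sum>k\<in>UNIV. \<Sum>l\<in>UNIV. B $ i $ j * B $ k $ l *
      (of_bool (i = j \<and> k = l) + of_bool (i = k \<and> j = l) + of_bool (i = l \<and> j = k)))"
    (is "has_bochner_integral M _ ?E")
    unfolding Q2_eq
    by (intro has_bochner_integral_sum has_bochner_integral_cmult
        std_normal_product4 [OF assms(1,2)])
  \<comment> \<open>One contribution per pairing: the pairing within each factor of the square gives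
    the squared trace, the two pairings across the factors give the squared norm each.\<close>
  moreover have "?E = (trace B)\<^sup>2 + 2 * (norm B)\<^sup>2"
  proof -
    have 1: "(\<Sum>i\<in>UNIV. \<Sum>j\<in>UNIV. \<Sum>k\<in>UNIV. \<Sum>l\<in>UNIV. B $ i $ j * B $ k $ l *
        of_bool (i = j \<and> k = l)) = (trace B)\<^sup>2"
    proof -
      have "(\<Sum>i\<in>UNIV. \<Sum>j\<in>UNIV. \<Sum>k\<in>UNIV. \<Sum>l\<in>UNIV. B $ i $ j * B $ k $ l *
        of_bool (i = j \<and> k = l)) =
        (\<Sum>i\<in>UNIV. \<Sum>j\<in>UNIV. B $ i $ j * of_bool (i = j) *
          (\<Sum>k\<in>UNIV. \<Sum>l\<in>UNIV. B $ k $ l * of_bool (k = l)))"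
        by (intro sum.cong refl) (simp add: sum_distrib_left of_bool_conj mult_ac)
      also have "\<dots> = (trace B)\<^sup>2"
        by (simp only: sum_distrib_right [symmetric] sum_mult_of_bool_eq trace_def power2_eq_square)
      finally show ?thesis .
    qed
    have 2: "(\<Sum>i\<in>UNIV. \<Sum>j\<in>UNIV. \<Sum>k\<in>UNIV. \<Sum>l\<in>UNIV. B $ i $ j * B $ k $ l *
        of_bool (i = k \<and> j = l)) = (norm B)\<^sup>2"
      unfolding norm_matrix_squared
      by (simp only: power2_eq_square of_bool_conj mult.assoc [symmetric]
          sum_mult_of_bool_eq)
    \<comment> \<open>The innermost sum is over \<open>l\<close>, so its delta has to stand last,
      hence the swap. What remains is the sum of \<open>B $ i $ j * B $ j $ i\<close>, where
      symmetry enters.\<close>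
    have 3: "(\<Sum>i\<in>UNIV. \<Sum>j\<in>UNIV. \<Sum>k\<in>UNIV. \<Sum>l\<in>UNIV. B $ i $ j * B $ k $ l *
        of_bool (i = l \<and> j = k)) = (norm B)\<^sup>2"
      unfolding norm_matrix_squared
      by (subst conj_commute)
        (simp only: power2_eq_square of_bool_conj mult.assoc [symmetric]
          sum_mult_of_bool_eq sym)
    show ?thesis
      by (simp only: distrib_left sum.distrib 1 2 3)
  qed
  ultimately have Q2: "has_bochner_integral M (\<lambda>\<omega>. (?Q \<omega>)\<^sup>2) ((trace B)\<^sup>2 + 2 * (norm B)\<^sup>2)"
    by simp
  have "has_bochner_integral M (\<lambda>\<omega>. ((?Q \<omega>)\<^sup>2 + (trace B)\<^sup>2) - 2 * trace B * ?Q \<omega>)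
      (((trace B)\<^sup>2 + 2 * (norm B)\<^sup>2 + (trace B)\<^sup>2) - 2 * trace B * trace B)"
    by (intro has_bochner_integral_diff has_bochner_integral_add Q2 has_bochner_integral_const
        has_bochner_integral_cmult Q)
  then show "has_bochner_integral M (\<lambda>\<omega>. (?Q \<omega> - trace B)\<^sup>2) (2 * (norm B)\<^sup>2)"
    by (simp add: power2_diff mult.assoc mult.commute [of _ "trace B"]) (simp add: power2_eq_square)
qed

subsection \<open>A strong law for nonnegative random variables\<close>

text \<open>Additivity of the variance: after centering, the square of the sum expands into products
  \<open>D i * D j\<close>, and independence gives the off-diagonal ones expectation 0. It serves
  both the strong law and the variance of the sample mean.\<close>

lemma has_bochner_integral_sum_square:
  fixes X :: "nat \<Rightarrow> 'a \<Rightarrow> real" and \<mu> v :: real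
  assumes "finite I" and indep: "indep_vars (\<lambda>_. borel) X I"
    and mean: "\<And>j. j \<in> I \<Longrightarrow> has_bochner_integral M (X j) \<mu>"
    and var: "\<And>j. j \<in> I \<Longrightarrow> has_bochner_integral M (\<lambda>\<omega>. (X j \<omega> - \<mu>)\<^sup>2) v"
  shows "has_bochner_integral M (\<lambda>\<omega>. ((\<Sum>j\<in>I. X j \<omega>) - card I * \<mu>)\<^sup>2) (card I * v)"
proof -
  define D where "D j \<omega> = X j \<omega> - \<mu>" for j \<omega>
  have D: "has_bochner_integral M (D j) 0" if "j \<in> I" for j
    using has_bochner_integral_diff [OF mean [OF that] has_bochner_integral_const [of \<mu>]]
    by (simp add: D_def [abs_def])
  have indepD: "indep_vars (\<lambda>_. borel) D I"
    unfolding D_def by (rule indep_vars_compose2 [OF indep]) simp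
  have DD: "has_bochner_integral M (\<lambda>\<omega>. D i \<omega> * D j \<omega>) (if j = i then v else 0)"
    if ij: "i \<in> I" "j \<in> I" for i j
  proof (cases "i = j")
    case True
    then show ?thesis using var [OF ij(1)] by (simp add: D_def power2_eq_square)
  next
    case False
    have indep2: "indep_vars (\<lambda>_. borel) D {i, j}"
      by (rule indep_vars_subset [OF indepD]) (use ij in auto)
    have int: "integrable M (D m)" if "m \<in> {i, j}" for m
      using D that ij by (auto simp: has_bochner_integral_iff)
    show ?thesis
      using indep_vars_lebesgue_integral [OF _ indep2 int] indep_vars_integrable [OF _ indep2 int]
        False D [OF ij(1)] by (simp add: has_bochner_integral_iff)
  qed
  have "has_bochner_integral M (\<lambda>\<omega>. \<Sum>i\<in>I. \<Sum>j\<in>I. D i \<omega> * D j \<omega>)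
      (\<Sum>i\<in>I. \<Sum>j\<in>I. if j = i then v else 0)"
    by (intro has_bochner_integral_sum DD)
  then show ?thesis
    using \<open>finite I\<close> by (simp add: D_def sum_product [symmetric] power2_eq_square sum_subtractf)
qed

end

text \<open>With \<open>k = floor_sqrt n\<close>, \<open>n\<close> lies between \<open>k^2\<close>
  and \<open>(k + 1)^2\<close>. By monotonicity \<open>S n / n\<close> lies between
  \<open>S (k^2) / (k + 1)^2\<close> and \<open>S ((k + 1)^2) / k^2\<close>, and the ratio of
  consecutive squares tends to 1.\<close>

lemma tendsto_average_from_squares:
  fixes S :: "nat \<Rightarrow> real"
  assumes inc: "incseq S" and pos: "\<And>n. 0 \<le> S n"
    and lim: "(\<lambda>k. S (k\<^sup>2) / real (k\<^sup>2)) \<longlonglongrightarrow> \<mu>"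
  shows "(\<lambda>n. S n / real n) \<longlonglongrightarrow> \<mu>"
proof -
  have sqrt_top: "filterlim floor_sqrt at_top sequentially"
    unfolding filterlim_at_top
    by (auto simp: le_floor_sqrt_iff eventually_at_top_linorder)
  have ratio: "(\<lambda>k. (real k)\<^sup>2 / (real (Suc k))\<^sup>2) \<longlonglongrightarrow> 1"
    by real_asymp
  have ratio': "(\<lambda>k. (real (Suc k))\<^sup>2 / (real k)\<^sup>2) \<longlonglongrightarrow> 1"
    by real_asymp
  have "(\<lambda>k. S (k\<^sup>2) / real (k\<^sup>2) * ((real k)\<^sup>2 / (real (Suc k))\<^sup>2)) \<longlonglongrightarrow> \<mu> * 1"
    by (intro tendsto_mult lim ratio)
  \<comment> \<open>At \<open>k = 0\<close> the left side is 0 by division by zero while the right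
    side is \<open>S 0\<close>, so the equality is claimed for positive \<open>k\<close>
    only.\<close>
  moreover have "S (k\<^sup>2) / real (k\<^sup>2) * ((real k)\<^sup>2 / (real (Suc k))\<^sup>2) = S (k\<^sup>2) / (real (Suc k))\<^sup>2"
    if "0 < k" for k
    using that by simp
  ultimately have "(\<lambda>k. S (k\<^sup>2) / (real (Suc k))\<^sup>2) \<longlonglongrightarrow> \<mu>"
    by (auto elim!: Lim_transform_eventually intro!: eventually_mono [OF eventually_gt_at_top [of 0]])
  note low = filterlim_compose [OF this sqrt_top]
  have "(\<lambda>k. S ((Suc k)\<^sup>2) / real ((Suc k)\<^sup>2) * ((real (Suc k))\<^sup>2 / (real k)\<^sup>2)) \<longlonglongrightarrow> \<mu> * 1"
    by (intro tendsto_mult LIMSEQ_Suc [OF lim] ratio')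
  then have "(\<lambda>k. S ((Suc k)\<^sup>2) / (real k)\<^sup>2) \<longlonglongrightarrow> \<mu>"
    by simp
  note high = filterlim_compose [OF this sqrt_top]
  show ?thesis
  proof (rule tendsto_sandwich [OF _ _ low high])
    show "\<forall>\<^sub>F n in sequentially. S ((floor_sqrt n)\<^sup>2) / (real (Suc (floor_sqrt n)))\<^sup>2 \<le> S n / real n"
    proof (rule eventually_mono [OF eventually_gt_at_top [of 0]])
      fix n :: nat assume "0 < n"
      have "n \<le> (Suc (floor_sqrt n))\<^sup>2"
        using Suc_floor_sqrt_power2_gt [of n] by simp
      then have "real n \<le> (real (Suc (floor_sqrt n)))\<^sup>2"
        by (metis of_nat_le_iff of_nat_power)
      then show "S ((floor_sqrt n)\<^sup>2) / (real (Suc (floor_sqrt n)))\<^sup>2 \<le> S n / real n"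
        using \<open>0 < n\<close> by (intro frac_le pos incseqD [OF inc]) auto
    qed
    show "\<forall>\<^sub>F n in sequentially. S n / real n \<le> S ((Suc (floor_sqrt n))\<^sup>2) / (real (floor_sqrt n))\<^sup>2"
    proof (rule eventually_mono [OF eventually_gt_at_top [of 0]])
      fix n :: nat assume "0 < n"
      have "(real (floor_sqrt n))\<^sup>2 \<le> real n"
        by (metis floor_sqrt_power2_le of_nat_le_iff of_nat_power)
      then show "S n / real n \<le> S ((Suc (floor_sqrt n))\<^sup>2) / (real (floor_sqrt n))\<^sup>2"
        using \<open>0 < n\<close> Suc_floor_sqrt_power2_gt [of n]
        by (intro frac_le pos incseqD [OF inc]) auto
    qed
  qed
qed

context prob_space
begin

text \<open>Exchanging sum and integral, the series of squares has finite expectation. It is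
  therefore finite almost surely, and its terms tend to 0.\<close>

lemma AE_tendsto_0_if_summable_second_moments:
  fixes Y :: "nat \<Rightarrow> 'a \<Rightarrow> real"
  assumes Y: "\<And>k. has_bochner_integral M (\<lambda>\<omega>. (Y k \<omega>)\<^sup>2) (s k)" and "summable s"
  shows "AE \<omega> in M. (\<lambda>k. Y k \<omega>) \<longlonglongrightarrow> 0"
proof -
  have [measurable]: "(\<lambda>\<omega>. (Y k \<omega>)\<^sup>2) \<in> borel_measurable M" for k
    using Y [of k] by (auto simp: has_bochner_integral_iff)
  have s: "(\<integral>\<^sup>+ \<omega>. ennreal ((Y k \<omega>)\<^sup>2) \<partial>M) = ennreal (s k)" "0 \<le> s k" for k
    using Y [of k] integral_nonneg_AE [where M = M and f = "\<lambda>\<omega>. (Y k \<omega>)\<^sup>2"]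
    by (auto simp: has_bochner_integral_iff nn_integral_eq_integral)
  have "(\<integral>\<^sup>+ \<omega>. (\<Sum>k. ennreal ((Y k \<omega>)\<^sup>2)) \<partial>M) = (\<Sum>k. ennreal (s k))"
    by (subst nn_integral_suminf) (simp_all add: s)
  also have "\<dots> = ennreal (suminf s)"
    using s(2) \<open>summable s\<close> by (rule suminf_ennreal2)
  finally have "AE \<omega> in M. (\<Sum>k. ennreal ((Y k \<omega>)\<^sup>2)) \<noteq> \<infinity>"
    by (intro nn_integral_noteq_infinite) simp_all
  then show ?thesis
  proof eventually_elim
    case (elim \<omega>)
    then have "summable (\<lambda>k. (Y k \<omega>)\<^sup>2)"
      by (intro summable_suminf_not_top) auto
    then have "(\<lambda>k. (Y k \<omega>)\<^sup>2) \<longlonglongrightarrow> 0"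
      by (rule summable_LIMSEQ_zero)
    then show ?case
      by simp
  qed
qed

lemma strong_law_nonneg:
  fixes X :: "nat \<Rightarrow> 'a \<Rightarrow> real" and \<mu> v :: real
  assumes nonneg: "\<And>j \<omega>. \<omega> \<in> space M \<Longrightarrow> 0 \<le> X j \<omega>"
    and indep: "indep_vars (\<lambda>_. borel) X {1..}"
    and mean: "\<And>j. 1 \<le> j \<Longrightarrow> has_bochner_integral M (X j) \<mu>"
    and var: "\<And>j. 1 \<le> j \<Longrightarrow> has_bochner_integral M (\<lambda>\<omega>. (X j \<omega> - \<mu>)\<^sup>2) v"
  shows "AE \<omega> in M. (\<lambda>n. (\<Sum>j = 1..n. X j \<omega>) / real n) \<longlonglongrightarrow> \<mu>"
proof -
  define S where "S \<omega> n = (\<Sum>j = 1..n. X j \<omega>)" for \<omega> n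
  have S: "has_bochner_integral M (\<lambda>\<omega>. (S \<omega> n - n * \<mu>)\<^sup>2) (n * v)" for n
    using has_bochner_integral_sum_square [of "{1..n}" X \<mu> v] indep_vars_subset [OF indep] mean var
    by (simp add: S_def subset_iff)
  \<comment> \<open>An average of \<open>n\<close> terms has variance \<open>v / n\<close>, which is
    summable along the squares. \<open>Suc k\<close> avoids the empty average, which is 0 by
    division by zero and need not be close to \<mu>.\<close>
  have "has_bochner_integral M (\<lambda>\<omega>. (S \<omega> ((Suc k)\<^sup>2) / real ((Suc k)\<^sup>2) - \<mu>)\<^sup>2)
      (v * inverse (real (Suc k) ^ 2))" for k
  proof -
    define m where "m = real ((Suc k)\<^sup>2)"
    have "0 < m" by (simp add: m_def)
    have "has_bochner_integral M (\<lambda>\<omega>. 1 / m\<^sup>2 * (S \<omega> ((Suc k)\<^sup>2) - m * \<mu>)\<^sup>2) (1 / m\<^sup>2 * (m * v))"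
      unfolding m_def by (intro has_bochner_integral_cmult S)
    moreover have "1 / m\<^sup>2 * (x - m * \<mu>)\<^sup>2 = (x / m - \<mu>)\<^sup>2" for x
      using \<open>0 < m\<close> by (simp add: power2_eq_square field_simps)
    moreover have "1 / m\<^sup>2 * (m * v) = v * inverse m"
      using \<open>0 < m\<close> by (simp add: power2_eq_square field_simps)
    ultimately show ?thesis
      by (simp add: m_def)
  qed
  moreover have "summable (\<lambda>k. v * inverse (real (Suc k) ^ 2))"
    using inverse_power_summable [of 2, where 'a = real]
    by (intro summable_mult) (subst summable_Suc_iff, simp)
  ultimately have "AE \<omega> in M. (\<lambda>k. S \<omega> ((Suc k)\<^sup>2) / real ((Suc k)\<^sup>2) - \<mu>) \<longlonglongrightarrow> 0"
    by (rule AE_tendsto_0_if_summable_second_moments)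
  then have "AE \<omega> in M. (\<lambda>n. S \<omega> n / real n) \<longlonglongrightarrow> \<mu>"
  proof (rule AE_mp, intro AE_I2 impI)
    fix \<omega> assume \<omega>: "\<omega> \<in> space M"
      and lim: "(\<lambda>k. S \<omega> ((Suc k)\<^sup>2) / real ((Suc k)\<^sup>2) - \<mu>) \<longlonglongrightarrow> 0"
    show "(\<lambda>n. S \<omega> n / real n) \<longlonglongrightarrow> \<mu>"
    proof (rule tendsto_average_from_squares)
      show "incseq (S \<omega>)"
        unfolding S_def by (intro incseq_SucI) (simp add: nonneg [OF \<omega>])
      show "0 \<le> S \<omega> n" for n
        unfolding S_def by (intro sum_nonneg nonneg [OF \<omega>])
      show "(\<lambda>k. S \<omega> (k\<^sup>2) / real (k\<^sup>2)) \<longlonglongrightarrow> \<mu>"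
        using lim unfolding LIM_zero_iff
        by (rule LIMSEQ_imp_Suc [where f = "\<lambda>k. S \<omega> (k\<^sup>2) / real (k\<^sup>2)"])
    qed
  qed
  then show ?thesis by (simp add: S_def)
qed

end

subsection \<open>Moments of a power with exponent at most one\<close>

text \<open>Weighted AM-GM for \<open>x\<close> and \<open>m\<close> with weights \<open>q\<close>
  and \<open>1 - q\<close>, multiplied by \<open>m powr (q - 1)\<close>. At \<open>x = 0\<close>,
  where \<open>0 powr q = 0\<close>, the claim reduces to \<open>q \<le> 1\<close>.\<close>

lemma powr_le_tangent:
  fixes x m q :: real
  assumes "0 \<le> x" "0 < m" "0 \<le> q" "q \<le> 1"
  shows "x powr q \<le> m powr q + q * m powr (q - 1) * (x - m)"
proof (cases "x = 0")
  case True
  have "m powr (q - 1) * m = m powr q"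
    using assms by (simp add: powr_diff)
  moreover have "q * m powr q \<le> 1 * m powr q"
    using assms by (intro mult_right_mono) auto
  ultimately show ?thesis
    using True by (simp add: mult.assoc)
next
  case False
  have "x powr q * m powr (1 - q) \<le> q * x + (1 - q) * m"
    using assms False by (intro Youngs_inequality_0) auto
  then have "x powr q * m powr (1 - q) * m powr (q - 1) \<le> (q * x + (1 - q) * m) * m powr (q - 1)"
    by (intro mult_right_mono) auto
  moreover have "x powr q * m powr (1 - q) * m powr (q - 1) = x powr q"
    using assms by (simp add: mult.assoc powr_add [symmetric])
  moreover have m: "m powr (q - 1) * m = m powr q"
    using assms by (simp add: powr_diff)
  have "(q * x + (1 - q) * m) * m powr (q - 1) = m powr q + q * m powr (q - 1) * (x - m)"
    unfolding m [symmetric] by (simp add: algebra_simps)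
  ultimately show ?thesis
    by simp
qed

text \<open>In \<open>x powr q = x powr (q - 1) * x\<close> the first factor is nonincreasing in
  positive \<open>x\<close>; it is compared with its value at \<open>m\<close>. Both sides agree at
  \<open>x = 0\<close>, so for \<open>q < 1\<close> the tangent slope
  \<open>q * m powr (q - 1)\<close> would be too small a constant.\<close>

lemma abs_powr_diff_le:
  fixes x m q :: real
  assumes "0 \<le> x" "0 < m" "0 \<le> q" "q \<le> 1"
  shows "\<bar>x powr q - m powr q\<bar> \<le> m powr (q - 1) * \<bar>x - m\<bar>"
proof -
  have mq: "m powr (q - 1) * m = m powr q"
    using assms by (simp add: powr_diff)
  have x: "x powr (q - 1) * x = x powr q"
    using assms by (simp add: powr_diff)
  show ?thesis
  proof (cases "m \<le> x")
    case True
    then have "x powr (q - 1) * x \<le> m powr (q - 1) * x"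
      using assms by (intro mult_right_mono powr_mono2') auto
    moreover have "m powr q \<le> x powr q"
      using assms True by (intro powr_mono2) auto
    ultimately show ?thesis
      using True mq x by (simp add: algebra_simps)
  next
    case False
    \<comment> \<open>The nonpositive power is antitone for a positive base only; at
      \<open>x = 0\<close> both sides vanish.\<close>
    then have "m powr (q - 1) * x \<le> x powr (q - 1) * x"
      using assms by (cases "x = 0") (auto intro!: mult_right_mono powr_mono2')
    moreover have "x powr q \<le> m powr q"
      using assms False by (intro powr_mono2) auto
    ultimately show ?thesis
      using False mq x by (simp add: algebra_simps)
  qed
qed

context prob_space
begin

text \<open>The two sides differ by the square of \<open>expectation Y - c\<close>. This allows
  centering at \<mu> to the power \<open>q\<close> in place of the unknown mean of the
  power.\<close>

lemma variance_le_second_moment: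
  fixes Y :: "'a \<Rightarrow> real"
  assumes "integrable M Y" "integrable M (\<lambda>\<omega>. (Y \<omega>)\<^sup>2)"
  shows "variance Y \<le> expectation (\<lambda>\<omega>. (Y \<omega> - c)\<^sup>2)"
proof -
  have "expectation (\<lambda>\<omega>. (Y \<omega> - c)\<^sup>2) = expectation (\<lambda>\<omega>. (Y \<omega>)\<^sup>2) + c\<^sup>2 - 2 * expectation Y * c"
    using assms by (simp add: power2_diff prob_space)
  also have "\<dots> = variance Y + (expectation Y - c)\<^sup>2"
    unfolding variance_eq [OF assms] by (simp add: power2_diff)
  finally show ?thesis by simp
qed

text \<open>Applied below to the sample mean with \<open>q = 1 / p\<close>, where
  \<open>2 - 2 * q\<close> is the exponent \<open>2 - 2 / p\<close> of the variance bound.\<close>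

lemma powr_moments:
  fixes Z :: "'a \<Rightarrow> real"
  assumes nonneg: "\<And>\<omega>. \<omega> \<in> space M \<Longrightarrow> 0 \<le> Z \<omega>"
    and mean: "has_bochner_integral M Z \<mu>"
    and var: "has_bochner_integral M (\<lambda>\<omega>. (Z \<omega> - \<mu>)\<^sup>2) v"
    and q: "0 < q" "q \<le> 1"
  shows "integrable M (\<lambda>\<omega>. Z \<omega> powr q)"
    and "integrable M (\<lambda>\<omega>. (Z \<omega> powr q)\<^sup>2)"
    and "expectation (\<lambda>\<omega>. Z \<omega> powr q) \<le> \<mu> powr q"
    and "variance (\<lambda>\<omega>. Z \<omega> powr q) \<le> v / \<mu> powr (2 - 2 * q)"
proof -
  note Z = mean [unfolded has_bochner_integral_iff] and V = var [unfolded has_bochner_integral_iff]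
  have [measurable]: "Z \<in> borel_measurable M"
    using Z by auto
  \<comment> \<open>The tangent at 1 gives an integrable linear majorant.\<close>
  have le: "Z \<omega> powr q \<le> 1 + Z \<omega>" if "\<omega> \<in> space M" for \<omega>
  proof -
    have "q * (Z \<omega> - 1) \<le> Z \<omega>"
      using q nonneg [OF that] mult_right_mono [of q 1 "Z \<omega>"] by (simp add: algebra_simps)
    then show ?thesis
      using powr_le_tangent [of "Z \<omega>" 1 q] nonneg [OF that] q by simp
  qed
  show int: "integrable M (\<lambda>\<omega>. Z \<omega> powr q)"
    by (rule Bochner_Integration.integrable_bound [of _ "\<lambda>\<omega>. 1 + Z \<omega>"])
      (use Z le nonneg in \<open>auto intro!: AE_I2 simp: abs_of_nonneg\<close>)
  have "integrable M (\<lambda>\<omega>. 2 * (1 + \<mu>)\<^sup>2 + 2 * (Z \<omega> - \<mu>)\<^sup>2)"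
    using V by auto
  \<comment> \<open>Splitting \<open>1 + Z \<omega>\<close> as
    \<open>(1 + \<mu>) + (Z \<omega> - \<mu>)\<close> bounds its square by twice the sum of the two
    squares, so the given centered second moment suffices.\<close>
  moreover have "(Z \<omega> powr q)\<^sup>2 \<le> 2 * (1 + \<mu>)\<^sup>2 + 2 * (Z \<omega> - \<mu>)\<^sup>2" if "\<omega> \<in> space M" for \<omega>
  proof -
    have "(Z \<omega> powr q)\<^sup>2 \<le> (1 + Z \<omega>)\<^sup>2"
      using le [OF that] by (intro power_mono) auto
    also have "\<dots> \<le> 2 * (1 + \<mu>)\<^sup>2 + 2 * (Z \<omega> - \<mu>)\<^sup>2"
      using zero_le_power2 [of "(1 + \<mu>) - (Z \<omega> - \<mu>)"] by (simp add: power2_eq_square algebra_simps)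
    finally show ?thesis .
  qed
  ultimately show int2: "integrable M (\<lambda>\<omega>. (Z \<omega> powr q)\<^sup>2)"
    by (elim Bochner_Integration.integrable_bound) (auto intro!: AE_I2)
  have "0 \<le> \<mu>"
    using Z nonneg by (auto intro!: integral_nonneg_AE)
  then consider "\<mu> = 0" | "0 < \<mu>" by linarith
  then have "expectation (\<lambda>\<omega>. Z \<omega> powr q) \<le> \<mu> powr q \<and>
    variance (\<lambda>\<omega>. Z \<omega> powr q) \<le> v / \<mu> powr (2 - 2 * q)"
  proof cases
    case 1
    \<comment> \<open>\<open>v / 0 = 0\<close>, so the variance has to vanish.\<close>
    have "AE \<omega> in M. Z \<omega> = 0"
      using Z nonneg 1 by (subst integral_nonneg_eq_0_iff_AE [symmetric]) auto
    then have ae: "AE \<omega> in M. Z \<omega> powr q = 0"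
      by eventually_elim simp
    then have E0: "expectation (\<lambda>\<omega>. Z \<omega> powr q) = 0"
      by (rule integral_eq_zero_AE)
    have "variance (\<lambda>\<omega>. Z \<omega> powr q) = 0"
      unfolding E0 by (rule integral_eq_zero_AE) (use ae in \<open>eventually_elim, simp\<close>)
    with E0 1 show ?thesis by simp
  next
    case 2
    have "expectation (\<lambda>\<omega>. Z \<omega> powr q) \<le>
        expectation (\<lambda>\<omega>. \<mu> powr q + q * \<mu> powr (q - 1) * (Z \<omega> - \<mu>))"
      using int Z q nonneg 2 by (intro integral_mono powr_le_tangent) auto
    also have "\<dots> = \<mu> powr q"
      using Z by (simp add: prob_space)
    finally have E: "expectation (\<lambda>\<omega>. Z \<omega> powr q) \<le> \<mu> powr q" .
    have "variance (\<lambda>\<omega>. Z \<omega> powr q) \<le> expectation (\<lambda>\<omega>. (Z \<omega> powr q - \<mu> powr q)\<^sup>2)"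
      by (rule variance_le_second_moment [OF int int2])
    also have "\<dots> \<le> expectation (\<lambda>\<omega>. (\<mu> powr (q - 1))\<^sup>2 * (Z \<omega> - \<mu>)\<^sup>2)"
    proof (rule integral_mono)
      show "integrable M (\<lambda>\<omega>. (Z \<omega> powr q - \<mu> powr q)\<^sup>2)"
        using int int2 by (simp add: power2_diff)
      show "integrable M (\<lambda>\<omega>. (\<mu> powr (q - 1))\<^sup>2 * (Z \<omega> - \<mu>)\<^sup>2)"
        using V by auto
      fix \<omega> assume "\<omega> \<in> space M"
      then have "\<bar>Z \<omega> powr q - \<mu> powr q\<bar> \<le> \<bar>\<mu> powr (q - 1) * (Z \<omega> - \<mu>)\<bar>"
        using abs_powr_diff_le [of "Z \<omega>" \<mu> q] nonneg q 2 by (simp add: abs_mult)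
      then show "(Z \<omega> powr q - \<mu> powr q)\<^sup>2 \<le> (\<mu> powr (q - 1))\<^sup>2 * (Z \<omega> - \<mu>)\<^sup>2"
        by (simp only: abs_le_square_iff power_mult_distrib)
    qed
    also have "\<dots> = (\<mu> powr (q - 1))\<^sup>2 * v"
      using V by simp
    also have "(\<mu> powr (q - 1))\<^sup>2 = 1 / \<mu> powr (2 - 2 * q)"
      using 2 by (simp add: power2_eq_square powr_add [symmetric] powr_minus_divide [symmetric])
    finally show ?thesis
      using E by simp
  qed
  then show "expectation (\<lambda>\<omega>. Z \<omega> powr q) \<le> \<mu> powr q"
    and "variance (\<lambda>\<omega>. Z \<omega> powr q) \<le> v / \<mu> powr (2 - 2 * q)"
    by auto
qed

end

subsection \<open>The estimator\<close>

lemma sample_mean_nonneg: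
  assumes "symmetric_mat S"
  shows "0 \<le> sample_mean (S ** S) w M \<omega>"
  unfolding sample_mean_def
  by (intro mult_nonneg_nonneg sum_nonneg inner_square_nonneg assms) auto

context prob_space
begin

lemma samples_quadratic_form:
  fixes B :: "real ^ 'n ^ 'n" and w :: "nat \<Rightarrow> 'a \<Rightarrow> real ^ 'n"
  assumes w: "std_gaussian_samples M w" and "symmetric_mat B"
  shows "indep_vars (\<lambda>_. borel) (\<lambda>j \<omega>. w j \<omega> \<bullet> (B *v w j \<omega>)) {1..}"
    and "1 \<le> j \<Longrightarrow> has_bochner_integral M (\<lambda>\<omega>. w j \<omega> \<bullet> (B *v w j \<omega>)) (trace B)"
    and "1 \<le> j \<Longrightarrow>
      has_bochner_integral M (\<lambda>\<omega>. (w j \<omega> \<bullet> (B *v w j \<omega>) - trace B)\<^sup>2) (2 * (norm B)\<^sup>2)"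
proof -
  \<comment> \<open>Independence of the vectors passes to their images under a Borel map, and the
    quadratic form is continuous.\<close>
  have "(\<lambda>x. x \<bullet> (B *v x)) \<in> borel_measurable borel"
    by (intro borel_measurable_continuous_onI continuous_intros
        linear_continuous_on linear_linear [THEN iffD2] matrix_vector_mul_linear)
  then show "indep_vars (\<lambda>_. borel) (\<lambda>j \<omega>. w j \<omega> \<bullet> (B *v w j \<omega>)) {1..}"
    using w
    by (intro indep_vars_compose2
        [where Y = "\<lambda>_ x. x \<bullet> (B *v x)" and X = w and M' = "\<lambda>_. borel"])
      (auto simp: std_gaussian_samples_def)
  show "1 \<le> j \<Longrightarrow> has_bochner_integral M (\<lambda>\<omega>. w j \<omega> \<bullet> (B *v w j \<omega>)) (trace B)"
    and "1 \<le> j \<Longrightarrow>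
      has_bochner_integral M (\<lambda>\<omega>. (w j \<omega> \<bullet> (B *v w j \<omega>) - trace B)\<^sup>2) (2 * (norm B)\<^sup>2)"
    using w std_normal_quadratic_form [OF _ _ assms(2), of "w j"]
    by (auto simp: std_gaussian_samples_def)
qed

lemma sample_mean_moments:
  assumes "std_gaussian_samples M w" and "symmetric_mat B" and "1 \<le> m"
  shows "has_bochner_integral M (sample_mean B w m) (trace B)"
    and "has_bochner_integral M (\<lambda>\<omega>. (sample_mean B w m \<omega> - trace B)\<^sup>2) (2 * (norm B)\<^sup>2 / real m)"
proof -
  let ?S = "\<lambda>\<omega>. \<Sum>j = 1..m. w j \<omega> \<bullet> (B *v w j \<omega>)"
  note X = samples_quadratic_form [OF assms(1,2)]
  have "has_bochner_integral M (\<lambda>\<omega>. 1 / real m * ?S \<omega>) (1 / real m * (\<Sum>j = 1..m. trace B))"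
    by (intro has_bochner_integral_cmult has_bochner_integral_sum X(2)) simp
  then show "has_bochner_integral M (sample_mean B w m) (trace B)"
    using \<open>1 \<le> m\<close> by (simp add: sample_mean_def [abs_def])
  have "has_bochner_integral M (\<lambda>\<omega>. (?S \<omega> - card {1..m} * trace B)\<^sup>2) (card {1..m} * (2 * (norm B)\<^sup>2))"
    by (intro has_bochner_integral_sum_square indep_vars_subset [OF X(1)] X(2,3)) auto
  from has_bochner_integral_cmult [OF this, of "(1 / real m)\<^sup>2"]
  have "has_bochner_integral M (\<lambda>\<omega>. (1 / real m)\<^sup>2 * (?S \<omega> - m * trace B)\<^sup>2)
      ((1 / real m)\<^sup>2 * (m * (2 * (norm B)\<^sup>2)))"
    by simp
  moreover have "(1 / real m)\<^sup>2 * (x - m * trace B)\<^sup>2 = (1 / real m * x - trace B)\<^sup>2" for x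
    using \<open>1 \<le> m\<close> by (simp add: power2_eq_square field_simps)
  moreover have "(1 / real m)\<^sup>2 * (m * (2 * (norm B)\<^sup>2)) = 2 * (norm B)\<^sup>2 / m"
    using \<open>1 \<le> m\<close> by (simp add: power2_eq_square)
  ultimately show "has_bochner_integral M (\<lambda>\<omega>. (sample_mean B w m \<omega> - trace B)\<^sup>2) (2 * (norm B)\<^sup>2 / real m)"
    by (simp only: sample_mean_def)
qed

lemma sample_mean_tendsto:
  fixes S :: "real ^ 'n ^ 'n"
  assumes "std_gaussian_samples M w" and "symmetric_mat S"
  shows "AE \<omega> in M. (\<lambda>m. sample_mean (S ** S) w m \<omega>) \<longlonglongrightarrow> trace (S ** S)"
  using strong_law_nonneg [OF _ samples_quadratic_form [OF assms(1) symmetric_square [OF assms(2)]]]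
    inner_square_nonneg [OF assms(2)]
  by (simp add: sample_mean_def)

end

(* The library's powr is nonnegative at every real base, so part 1 also asserts that the base is
   nonnegative, i.e. that the p-th root is a genuine one.  Likewise the library's expectation and
   variance have default values, so parts 3 and 4 also assert integrability.  If the trace is 0,
   the right-hand side of part 4 is 0, by x / 0 = 0. *)

theorem proposition6:
  fixes A :: "real ^ 'n ^ 'n" and a b p :: real and N :: nat
    and P :: "'a measure" and w :: "nat \<Rightarrow> 'a \<Rightarrow> real ^ 'n"
  assumes "symmetric_mat A" and "pos_def_mat A"
    and "0 < a" and "a < b"
    and "\<And>\<mu>. eigenvalue_mat A \<mu> \<Longrightarrow> \<mu> \<in> {a..b}"
    and "1 \<le> p"
    and "prob_space P" and "std_gaussian_samples P w"
  shows
    "(\<forall>M\<ge>1. \<forall>\<omega>\<in>space P.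
        0 \<le> sample_mean (phi_mat p a b N A) w M \<omega> \<and>
        0 \<le> estimator p (phi_mat p a b N A) w M \<omega>) \<and>
     (AE \<omega> in P. (\<lambda>M. estimator p (phi_mat p a b N A) w M \<omega>)
        \<longlonglongrightarrow> trace (phi_mat p a b N A) powr (1 / p)) \<and>
     (\<forall>M\<ge>1. integrable P (estimator p (phi_mat p a b N A) w M) \<and>
        prob_space.expectation P (estimator p (phi_mat p a b N A) w M)
          \<le> trace (phi_mat p a b N A) powr (1 / p)) \<and>
     (\<forall>M\<ge>1. integrable P (\<lambda>\<omega>. (estimator p (phi_mat p a b N A) w M \<omega>)\<^sup>2) \<and>
        prob_space.variance P (estimator p (phi_mat p a b N A) w M)
          \<le> 2 * (norm (phi_mat p a b N A))\<^sup>2 /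
            (real M * trace (phi_mat p a b N A) powr (2 - 2 / p)))"
proof -
  interpret prob_space P by fact
  define S where "S = poly_mat (cheb_approx (\<lambda>x. x powr (p / 2)) a b N) A"
  define B where "B = S ** S"
  have phi: "phi_mat p a b N A = B"
    by (simp add: phi_mat_def B_def S_def Let_def)
  have S: "symmetric_mat S"
    unfolding S_def by (rule symmetric_poly_mat) fact
  then have B: "symmetric_mat B"
    unfolding B_def by (rule symmetric_square)
  have nonneg: "0 \<le> sample_mean B w M \<omega>" for M \<omega>
    unfolding B_def by (rule sample_mean_nonneg [OF S])
  note moments = powr_moments [OF nonneg sample_mean_moments [OF assms(8) B], of _ "1 / p"]
  have "AE \<omega> in P. (\<lambda>M. sample_mean B w M \<omega>) \<longlonglongrightarrow> trace B"
    unfolding B_def by (rule sample_mean_tendsto [OF assms(8) S])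
  then have "AE \<omega> in P. (\<lambda>M. estimator p B w M \<omega>) \<longlonglongrightarrow> trace B powr (1 / p)"
  proof eventually_elim
    case (elim \<omega>)
    \<comment> \<open>\<open>trace B\<close> may be 0. Convergence of the powers then rests on the
      positive exponent \<open>1 / p\<close> and the nonnegative sample means.\<close>
    then show ?case
      unfolding estimator_def using nonneg \<open>1 \<le> p\<close>
      by (intro tendsto_powr' tendsto_const) auto
  qed
  then show ?thesis
    using moments nonneg \<open>1 \<le> p\<close> unfolding phi
    by (simp add: estimator_def [abs_def])
qed

end
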